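(* Let $\mathbf S=(S,+,\cdot,0,{}',\le)$ be an ordered semiring with a unary operation and let $\odot$ and $\to$ denote the Sasaki operations on $S$, i.e. $x\odot y:=(x+y')y$ and $x\to y:=x'+xy$ for all $x,y\in S$. Consider the following conditions (for all $x,y,z\in S$): (3) $x\le y'+xyy$; (4) $x\le y$ implies $z'+zx\le z'+zy$; (5) $x\le y$ implies $xz\le yz$; (6) $xy\le x$. Then the following holds: (i) If $\mathbf S$ satisfies (3) and (4), then for all $x,y,z\in S$: $x\odot y\le z$ implies $x\le y\to z$. (ii) If $\mathbf S$ satisfies (5) and (6), then for all $x,y,z\in S$: $x\le y\to z$ implies $x\odot y\le z$. (iii) If $\mathbf S$ satisfies (3), (4), (5) and (6), then $\odot$ and $\to$ form an adjoint pair.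
   Context: A commutative semiring is an algebra $(S,+,\cdot,0)$ such that $(S,+,0)$ is a commutative monoid, $(S,\cdot)$ is a commutative semigroup, $x0=0$ for all $x\in S$, and $\cdot$ is distributive with respect to $+$ (no multiplicative unit is required). An ordered semiring with a unary operation is a sixtuple $(S,+,\cdot,0,{}',\le)$ where $(S,+,\cdot,0)$ is a commutative semiring, $'$ is a unary operation on $S$ satisfying the identity $xx'\approx0$, and $\le$ is a partial order relation on $S$ (no compatibility of $\le$ with the operations is assumed unless stated). Two binary operations $\odot$ and $\to$ on a poset $(S,\le)$ form an adjoint pair if for all $x,y,z\in S$: $x\odot y\le z$ if and only if $x\le y\to z$. *)

theory Defs
  imports Main
begin

text \<open>The commutative semirings (without a multiplicative unit) are exactly the class
  \<^class>\<open>comm_semiring_0\<close>. The partial order comes from \<^class>\<open>order\<close>, so it is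
  not assumed to be compatible with the operations, in contrast to the library class
  \<^class>\<open>ordered_comm_semiring\<close>.\<close>

locale ordered_semiring_unary =
  fixes c :: "'a::{comm_semiring_0, order} \<Rightarrow> 'a"
  assumes mult_c_eq_zero: "x * c x = 0"

definition sasaki_prod :: "('a::comm_semiring_0 \<Rightarrow> 'a) \<Rightarrow> 'a \<Rightarrow> 'a \<Rightarrow> 'a"
  where "sasaki_prod c x y = (x + c y) * y"

definition sasaki_imp :: "('a::comm_semiring_0 \<Rightarrow> 'a) \<Rightarrow> 'a \<Rightarrow> 'a \<Rightarrow> 'a"
  where "sasaki_imp c x y = c x + x * y"

definition adjoint_pair :: "('a::order \<Rightarrow> 'a \<Rightarrow> 'a) \<Rightarrow> ('a \<Rightarrow> 'a \<Rightarrow> 'a) \<Rightarrow> bool"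
  where "adjoint_pair f g \<longleftrightarrow> (\<forall>x y z. f x y \<le> z \<longleftrightarrow> x \<le> g y z)"

end

theory Submission
  imports Defs
begin

text \<open>Since \<open>y * c y = 0\<close>, the unary operation vanishes on multiplication by
  \<open>y\<close>: the Sasaki product is plain multiplication, and
  \<open>sasaki_imp c y z * y\<close> collapses to \<open>z * (y * y)\<close>. Each half of
  adjointness is then a two-step chain of inequalities, \<open>le_sasaki_imp\<close> and
  \<open>sasaki_prod_le\<close>.\<close>

context ordered_semiring_unary
begin

lemma sasaki_prod_eq_mult: "sasaki_prod c x y = x * y"
  using mult_c_eq_zero[of y] by (simp add: sasaki_prod_def algebra_simps)

lemma sasaki_imp_mult: "sasaki_imp c y z * y = z * (y * y)"
  using mult_c_eq_zero[of y] by (simp add: sasaki_imp_def algebra_simps)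

lemma le_sasaki_imp:
  assumes le: "\<And>x y. x \<le> c y + x * y * y"
    and mono: "\<And>x y z. x \<le> y \<Longrightarrow> c z + z * x \<le> c z + z * y"
    and "sasaki_prod c x y \<le> z"
  shows "x \<le> sasaki_imp c y z"
proof -
  \<comment> \<open>Commuting the factors exposes \<open>x * y\<close>, the Sasaki product, in the
    slot where \<open>mono\<close> can replace it by \<open>z\<close>.\<close>
  have "x \<le> c y + y * (x * y)"
    using le[of x y] by (simp add: ac_simps)
  also have "\<dots> \<le> c y + y * z"
    using assms(3) by (intro mono) (simp add: sasaki_prod_eq_mult)
  finally show ?thesis by (simp add: sasaki_imp_def)
qed

lemma sasaki_prod_le:
  assumes mono: "\<And>x y z :: 'a. x \<le> y \<Longrightarrow> x * z \<le> y * z"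
    and le: "\<And>x y :: 'a. x * y \<le> x"
    and "x \<le> sasaki_imp c y z"
  shows "sasaki_prod c x y \<le> z"
proof -
  \<comment> \<open>Multiplying by \<open>y\<close> cancels the summand \<open>c y\<close> and
    leaves a multiple of \<open>z\<close>, which lies below \<open>z\<close>.\<close>
  have "x * y \<le> sasaki_imp c y z * y"
    using assms(3) by (rule mono)
  also have "\<dots> \<le> z"
    unfolding sasaki_imp_mult by (rule le)
  finally show ?thesis by (simp add: sasaki_prod_eq_mult)
qed

end

theorem theorem4p1:
  fixes c :: "'a::{comm_semiring_0, order} \<Rightarrow> 'a"
  assumes "ordered_semiring_unary c"
  shows "((\<forall>x y. x \<le> c y + x * y * y) \<and>
          (\<forall>x y z. x \<le> y \<longrightarrow> c z + z * x \<le> c z + z * y) \<longrightarrow>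
          (\<forall>x y z. sasaki_prod c x y \<le> z \<longrightarrow> x \<le> sasaki_imp c y z)) \<and>
         ((\<forall>x y z::'a. x \<le> y \<longrightarrow> x * z \<le> y * z) \<and>
          (\<forall>x y::'a. x * y \<le> x) \<longrightarrow>
          (\<forall>x y z. x \<le> sasaki_imp c y z \<longrightarrow> sasaki_prod c x y \<le> z)) \<and>
         ((\<forall>x y. x \<le> c y + x * y * y) \<and>
          (\<forall>x y z. x \<le> y \<longrightarrow> c z + z * x \<le> c z + z * y) \<and>
          (\<forall>x y z::'a. x \<le> y \<longrightarrow> x * z \<le> y * z) \<and>
          (\<forall>x y::'a. x * y \<le> x) \<longrightarrow>
          adjoint_pair (sasaki_prod c) (sasaki_imp c))"
proof -
  interpret ordered_semiring_unary c by fact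
  show ?thesis
    unfolding adjoint_pair_def
    \<comment> \<open>Splitting the equivalence in the adjointness claim yields the same two
      implications as the first two claims.\<close>
    by (intro conjI impI allI iffI; elim conjE; (rule le_sasaki_imp | rule sasaki_prod_le); blast)
qed

end
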